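(* Let $c\in\mathbb{C}$ with $|c|=1$, let $E$ be a complex Banach space, let $I=\mathbb{R}$ or $I=[0,\infty)$, and let $f:I\to E$ be a bounded continuous function. Then $f$ is semi-$c$-periodic if and only if there exists a sequence $(f_n)$ of bounded continuous $c$-periodic functions $f_n:I\to E$ such that $\lim_{n\to\infty}f_n(x)=f(x)$ uniformly in $x\in I$.
   Context: $\mathbb{N}=\{1,2,\dots\}$; $\mathbb{S}:=\mathbb{N}$ if $I=[0,\infty)$ and $\mathbb{S}:=\mathbb{Z}$ if $I=\mathbb{R}$. A continuous function $f:I\to E$ is semi-$c$-periodic if for every $\varepsilon>0$ there exists $p>0$ such that $\|f(x+mp)-c^{m}f(x)\|\le\varepsilon$ for all $m\in\mathbb{S}$ and all $x\in I$. A function $g:I\to E$ is $c$-periodic if there exists $p>0$ such that $g(x+p)=cg(x)$ for all $x\in I$. (The number $p$ may depend on $g$; in particular the $f_n$ need not share a common $p$.) *)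

theory Defs
  imports "HOL-Analysis.Analysis"
begin

text \<open>
  HOL-Analysis provides real Banach spaces only.  A complex Banach space is a Banach space whose
  real scalar multiplication is the restriction of a complex one, with respect to which the norm
  is absolutely homogeneous.
\<close>

class complex_banach = banach +
  fixes scaleC :: "complex \<Rightarrow> 'a \<Rightarrow> 'a"  (infixr "*\<^sub>C" 75)
  assumes scaleC_add_right: "a *\<^sub>C (x + y) = a *\<^sub>C x + a *\<^sub>C y"
    and scaleC_add_left: "(a + b) *\<^sub>C x = a *\<^sub>C x + b *\<^sub>C x"
    and scaleC_scaleC: "a *\<^sub>C (b *\<^sub>C x) = (a * b) *\<^sub>C x"
    and scaleC_one: "1 *\<^sub>C x = x"
    and scaleR_scaleC: "r *\<^sub>R x = complex_of_real r *\<^sub>C x"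
    and norm_scaleC: "norm (a *\<^sub>C x) = cmod a * norm x"

instantiation complex :: complex_banach
begin

definition scaleC_complex :: "complex \<Rightarrow> complex \<Rightarrow> complex" where
  "scaleC_complex a x = a * x"

instance
  by standard (simp_all add: scaleC_complex_def algebra_simps norm_mult scaleR_conv_of_real)

end

text \<open>
  Functions \<open>I \<rightarrow> E\<close> are total functions on the reals of which only the values on \<open>I\<close> are used;
  \<open>I\<close> is meant to be \<open>UNIV\<close> or \<open>{0..}\<close>.  Shifts are indexed by all integers in the first case and
  by the integers \<open>m \<ge> 1\<close> in the second.
\<close>

definition shift_indices :: "real set \<Rightarrow> int set" where
  "shift_indices I = (if I = UNIV then UNIV else {1..})"

definition semi_c_periodic ::
    "complex \<Rightarrow> real set \<Rightarrow> (real \<Rightarrow> 'e::complex_banach) \<Rightarrow> bool" where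
  "semi_c_periodic c I f \<longleftrightarrow>
     continuous_on I f \<and>
     (\<forall>\<epsilon>>0. \<exists>p>0. \<forall>m\<in>shift_indices I. \<forall>x\<in>I.
        norm (f (x + of_int m * p) - (c powi m) *\<^sub>C f x) \<le> \<epsilon>)"

definition c_periodic ::
    "complex \<Rightarrow> real set \<Rightarrow> (real \<Rightarrow> 'e::complex_banach) \<Rightarrow> bool" where
  "c_periodic c I g \<longleftrightarrow> (\<exists>p>0. \<forall>x\<in>I. g (x + p) = c *\<^sub>C g x)"

end

theory Submission
  imports Defs
begin

text \<open>
  A uniform limit of \<open>c\<close>-periodic functions is semi-\<open>c\<close>-periodic because multiplication by
  \<open>c\<close> is an isometry: a function within \<open>\<epsilon> / 2\<close> of a \<open>c\<close>-periodic function inherits its law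
  \<open>g (x + m p) = c\<^sup>m g x\<close> up to \<open>\<epsilon>\<close>, whatever \<open>m\<close> is.

  Conversely, suppose that \<open>p\<close> satisfies the definition of semi-\<open>c\<close>-periodicity of \<open>f\<close> for \<open>\<epsilon>\<close>.
  The values of \<open>f\<close> on \<open>[0, p]\<close> alone then determine \<open>f\<close> up to \<open>\<epsilon>\<close>, since \<open>f (y + m p)\<close> is
  close to \<open>c\<^sup>m f y\<close>.  Copying \<open>f\<close> from \<open>[0, p]\<close> to the other intervals \<open>[m p, (m + 1) p]\<close> with
  the factors \<open>c\<^sup>m\<close> would give a \<open>c\<close>-periodic function, except that the copies need not fit
  together continuously: this requires the value at \<open>p\<close> to be \<open>c\<close> times the value at \<open>0\<close>.
  As \<open>f p\<close> differs from \<open>c f 0\<close> by at most \<open>\<epsilon>\<close>, adding a linear correction of size at most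
  \<open>\<epsilon>\<close> on \<open>[0, p]\<close> repairs this, and the resulting continuous \<open>c\<close>-periodic function
  (\<open>c_periodic_extension\<close>) stays within \<open>2 \<epsilon>\<close> of \<open>f\<close> (\<open>semi_c_periodic_approx\<close>).
\<close>

lemma bounded_linear_scaleC: "bounded_linear (\<lambda>x::'e::complex_banach. a *\<^sub>C x)"
proof (rule bounded_linear_intro)
  show "a *\<^sub>C (r *\<^sub>R x) = r *\<^sub>R (a *\<^sub>C x)" for r and x :: 'e
    by (simp add: scaleR_scaleC scaleC_scaleC mult.commute)
  show "norm (a *\<^sub>C x) \<le> norm x * cmod a" for x :: 'e
    by (simp add: norm_scaleC mult.commute)
qed (rule scaleC_add_right)

lemmas scaleC_diff_right = linear_diff [OF bounded_linear.linear [OF bounded_linear_scaleC]]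

lemma scaleC_powi_one_add:
  assumes "c \<noteq> 0"
  shows "c powi (1 + n) *\<^sub>C x = c *\<^sub>C (c powi n *\<^sub>C (x::'e::complex_banach))"
  using assms by (simp add: scaleC_scaleC power_int_add)

lemma c_periodic_shift_nat:
  fixes g :: "real \<Rightarrow> 'e::complex_banach"
  assumes p: "p > 0" and I: "I = UNIV \<or> I = {0..}"
    and g: "\<And>x. x \<in> I \<Longrightarrow> g (x + p) = c *\<^sub>C g x" and x: "x \<in> I"
  shows "g (x + real k * p) = c ^ k *\<^sub>C g x"
proof (induction k)
  case 0
  show ?case by (simp add: scaleC_one)
next
  case (Suc k)
  have "x + real k * p \<in> I"
    using I p x by auto
  from g [OF this] Suc show ?case
    by (simp add: scaleC_scaleC algebra_simps)
qed

lemma c_periodic_shift: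
  fixes g :: "real \<Rightarrow> 'e::complex_banach"
  assumes "p > 0" and I: "I = UNIV \<or> I = {0..}" and c: "c \<noteq> 0"
    and "\<And>x. x \<in> I \<Longrightarrow> g (x + p) = c *\<^sub>C g x" and x: "x \<in> I"
    and m: "m \<in> shift_indices I"
  shows "g (x + of_int m * p) = c powi m *\<^sub>C g x"
proof -
  have shift: "g (y + real k * p) = c ^ k *\<^sub>C g y" if "y \<in> I" for y k
    using assms that by (intro c_periodic_shift_nat [where I = I]) auto
  show ?thesis
  proof (cases "m \<ge> 0")
    case True
    then show ?thesis
      using shift [OF x, of "nat m"] by (simp add: power_int_def)
  next
    case False
    define k where "k = nat (- m)"
    have mk: "m = - int k"
      using False by (simp add: k_def)
    have "I = UNIV"
      using False m by (auto simp: shift_indices_def split: if_splits)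
    then have "g (x + of_int m * p + real k * p) = c ^ k *\<^sub>C g (x + of_int m * p)"
      using shift by simp
    then have "g x = c ^ k *\<^sub>C g (x + of_int m * p)"
      by (simp add: mk)
    then show ?thesis
      using c by (simp add: mk scaleC_scaleC scaleC_one power_int_minus)
  qed
qed

lemma shift_indices_closed:
  assumes "I = UNIV \<or> I = {0..}" "p > 0" "m \<in> shift_indices I" "x \<in> I"
  shows "x + of_int m * p \<in> I"
  using assms by (auto simp: shift_indices_def split: if_splits)

text \<open>
  The condition \<open>h p = c h 0\<close> is exactly what makes the two pieces that meet at a multiple of \<open>p\<close>
  agree there.  The extension is continuous on the whole line also if only \<open>[0,\<infinity>)\<close> is of
  interest, so both cases for \<open>I\<close> can be served at once.
\<close>

lemma c_periodic_extension:
  fixes h :: "real \<Rightarrow> 'e::complex_banach"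
  assumes c: "c \<noteq> 0" and p: "p > 0"
    and cont: "continuous_on {0..p} h" and ends: "h p = c *\<^sub>C h 0"
  obtains g where "continuous_on UNIV g" "\<And>x. g (x + p) = c *\<^sub>C g x"
    "\<And>n y. y \<in> {0..p} \<Longrightarrow> g (y + of_int n * p) = c powi n *\<^sub>C h y"
proof -
  define g where "g x = c powi \<lfloor>x / p\<rfloor> *\<^sub>C h (x - of_int \<lfloor>x / p\<rfloor> * p)" for x
  have piece: "g (y + of_int n * p) = c powi n *\<^sub>C h y" if y: "y \<in> {0..p}" for n y
  proof (cases "y = p")
    case True
    \<comment> \<open>The right end point belongs to the next half-open piece.\<close>
    have eq: "y + of_int n * p = of_int (n + 1) * p"
      using True by (simp add: algebra_simps)
    show ?thesis
      unfolding g_def eq using p True c ends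
      by (simp add: scaleC_scaleC power_int_add_1)
  next
    case False
    then have "\<lfloor>y / p + of_int n\<rfloor> = n"
      using y p by (simp add: floor_eq_iff)
    then have "\<lfloor>(y + of_int n * p) / p\<rfloor> = n"
      using p by (simp add: add_divide_distrib)
    then show ?thesis
      by (simp add: g_def)
  qed
  have "g (x + p) = c *\<^sub>C g x" for x
  proof -
    have "\<lfloor>(x + p) / p\<rfloor> = \<lfloor>x / p\<rfloor> + 1"
      using p by (simp add: add_divide_distrib)
    then show ?thesis
      using c by (simp add: g_def scaleC_powi_one_add algebra_simps)
  qed
  moreover have "continuous_on UNIV g"
  proof -
    have closed_piece: "continuous_on {of_int n * p .. of_int (n + 1) * p} g" for n
    proof (rule continuous_on_eq)
      show "continuous_on {of_int n * p .. of_int (n + 1) * p}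
              (\<lambda>x. c powi n *\<^sub>C h (x - of_int n * p))"
        by (intro bounded_linear.continuous_on [OF bounded_linear_scaleC]
              continuous_on_compose2 [OF cont] continuous_intros)
          (auto simp: algebra_simps)
      show "c powi n *\<^sub>C h (x - of_int n * p) = g x"
        if "x \<in> {of_int n * p .. of_int (n + 1) * p}" for x
        using piece [of "x - of_int n * p" n] that by (simp add: algebra_simps)
    qed
    have "isCont g x" for x
    proof -
      define n where "n = \<lfloor>x / p\<rfloor>"
      have "of_int n \<le> x / p" "x / p < of_int n + 1"
        unfolding n_def by linarith+
      then have x: "of_int n * p \<le> x" "x < of_int (n + 1) * p"
        using p by (simp_all add: field_simps)
      \<comment> \<open>The point may be the left end of its piece, so the preceding piece is added to get a
        neighbourhood.\<close>
      let ?U = "{of_int (n - 1) * p .. of_int n * p} \<union> {of_int n * p .. of_int (n + 1) * p}"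
      have "continuous_on ?U g"
        using closed_piece [of "n - 1"] closed_piece [of n]
        by (intro continuous_on_closed_Un) auto
      moreover have "{of_int (n - 1) * p <..< of_int (n + 1) * p} \<subseteq> ?U"
        by auto
      ultimately have "continuous_on {of_int (n - 1) * p <..< of_int (n + 1) * p} g"
        by (rule continuous_on_subset)
      moreover have "x \<in> {of_int (n - 1) * p <..< of_int (n + 1) * p}"
        using x p by (auto simp: algebra_simps)
      ultimately show ?thesis
        by (simp add: continuous_on_eq_continuous_at)
    qed
    then show ?thesis
      by (simp add: continuous_at_imp_continuous_on)
  qed
  ultimately show ?thesis
    using piece that by blast
qed

text \<open>
  The correction that is added on \<open>[0, p]\<close> interpolates linearly between \<open>0\<close> and the defect
  \<open>c f 0 - f p\<close>; one \<open>\<epsilon>\<close> of the bound pays for it and the other for replacing \<open>f (y + m p)\<close> by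
  \<open>c\<^sup>m f y\<close>.
\<close>

lemma semi_c_periodic_approx:
  fixes f :: "real \<Rightarrow> 'e::complex_banach"
  assumes c: "cmod c = 1" and I: "I = UNIV \<or> I = {0..}"
    and f: "semi_c_periodic c I f" and \<epsilon>: "\<epsilon> > 0"
  obtains g where "continuous_on I g" "c_periodic c I g" "\<And>x. x \<in> I \<Longrightarrow> dist (g x) (f x) \<le> 2 * \<epsilon>"
proof -
  have c0: "c \<noteq> 0"
    using c by auto
  obtain p where p: "p > 0" and semi:
    "\<And>m x. m \<in> shift_indices I \<Longrightarrow> x \<in> I \<Longrightarrow> norm (f (x + of_int m * p) - c powi m *\<^sub>C f x) \<le> \<epsilon>"
    using f \<epsilon> unfolding semi_c_periodic_def by meson
  have nonneg: "x \<in> I" if "x \<ge> 0" for x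
    using I that by auto
  define d where "d = c *\<^sub>C f 0 - f p"
  have d: "norm d \<le> \<epsilon>"
    using semi [of 1 0] nonneg [of 0] by (simp add: d_def shift_indices_def norm_minus_commute)
  define h where "h y = f y + (y / p) *\<^sub>R d" for y
  have "continuous_on {0..p} f"
    using f nonneg unfolding semi_c_periodic_def by (auto intro: continuous_on_subset)
  then have "continuous_on {0..p} h"
    unfolding h_def using p by (auto intro!: continuous_intros)
  moreover have "h p = c *\<^sub>C h 0"
    using p by (simp add: h_def d_def)
  ultimately obtain g where cont: "continuous_on UNIV g" and per: "\<And>x. g (x + p) = c *\<^sub>C g x"
    and piece: "\<And>n y. y \<in> {0..p} \<Longrightarrow> g (y + of_int n * p) = c powi n *\<^sub>C h y"
    using c_periodic_extension [OF c0 p] by metis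
  have "dist (g x) (f x) \<le> 2 * \<epsilon>" if x: "x \<in> I" for x
  proof -
    define n where "n = \<lfloor>x / p\<rfloor>"
    define y where "y = x - of_int n * p"
    have "of_int n \<le> x / p" "x / p < of_int n + 1"
      unfolding n_def by linarith+
    then have y: "y \<in> {0..p}"
      using p by (simp add: y_def field_simps)
    have xy: "x = y + of_int n * p"
      by (simp add: y_def)
    \<comment> \<open>On the half-line the index \<open>0\<close> is not an admissible shift, but is trivial.\<close>
    have "n = 0 \<or> n \<in> shift_indices I"
    proof (cases "I = UNIV")
      case True
      then show ?thesis by (simp add: shift_indices_def)
    next
      case False
      then have "0 \<le> x / p"
        using I x p by simp
      then have "n \<ge> 0"
        by (simp add: n_def)
      then show ?thesis
        using False by (auto simp: shift_indices_def)
    qed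
    then have "norm (c powi n *\<^sub>C f y - f x) \<le> \<epsilon>"
      using semi [of n y] nonneg [of y] y \<epsilon> xy
      by (auto simp: scaleC_one norm_minus_commute)
    moreover have "norm (c powi n *\<^sub>C h y - c powi n *\<^sub>C f y) \<le> \<epsilon>"
    proof -
      have "norm (c powi n *\<^sub>C h y - c powi n *\<^sub>C f y) = norm (h y - f y)"
        by (simp add: c norm_scaleC norm_power_int flip: scaleC_diff_right)
      also have "\<dots> = (y / p) * norm d"
        using y p by (simp add: h_def)
      also have "\<dots> \<le> 1 * norm d"
        using y p by (intro mult_right_mono) auto
      finally show ?thesis
        using d by simp
    qed
    ultimately have "norm (c powi n *\<^sub>C h y - f x) \<le> 2 * \<epsilon>"
      using norm_triangle_ineq [of "c powi n *\<^sub>C h y - c powi n *\<^sub>C f y" "c powi n *\<^sub>C f y - f x"]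
      by simp
    then show ?thesis
      using piece [OF y, of n] by (simp add: dist_norm flip: xy)
  qed
  moreover have "c_periodic c I g"
    using p per unfolding c_periodic_def by blast
  moreover have "continuous_on I g"
    using cont continuous_on_subset by blast
  ultimately show ?thesis
    using that by blast
qed

lemma uniform_limit_c_periodic_imp_semi_c_periodic:
  fixes f :: "real \<Rightarrow> 'e::complex_banach"
  assumes c: "cmod c = 1" and I: "I = UNIV \<or> I = {0..}" and f: "continuous_on I f"
    and F: "\<And>n. c_periodic c I (F n)" and lim: "uniform_limit I F f sequentially"
  shows "semi_c_periodic c I f"
  unfolding semi_c_periodic_def
proof (intro conjI allI impI)
  fix \<epsilon> :: real
  assume "\<epsilon> > 0"
  then have "\<forall>\<^sub>F n in sequentially. \<forall>x\<in>I. dist (F n x) (f x) < \<epsilon> / 2"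
    using lim by (intro uniform_limitD) auto
  then obtain n where n: "\<And>x. x \<in> I \<Longrightarrow> dist (F n x) (f x) < \<epsilon> / 2"
    unfolding eventually_sequentially by blast
  obtain p where p: "p > 0" and per: "\<And>x. x \<in> I \<Longrightarrow> F n (x + p) = c *\<^sub>C F n x"
    using F unfolding c_periodic_def by blast
  have "norm (f (x + of_int m * p) - c powi m *\<^sub>C f x) \<le> \<epsilon>"
    if m: "m \<in> shift_indices I" and x: "x \<in> I" for m x
  proof -
    have shift: "F n (x + of_int m * p) = c powi m *\<^sub>C F n x"
      using c p I per x m by (intro c_periodic_shift [where I = I]) auto
    have "norm (c powi m *\<^sub>C F n x - c powi m *\<^sub>C f x) = dist (F n x) (f x)"
      by (simp add: c norm_scaleC norm_power_int dist_norm flip: scaleC_diff_right)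
    moreover have "dist (F n (x + of_int m * p)) (f (x + of_int m * p)) < \<epsilon> / 2"
      using n shift_indices_closed [OF I p m x] by blast
    moreover have "dist (F n x) (f x) < \<epsilon> / 2"
      using n x by blast
    ultimately show ?thesis
      using norm_triangle_ineq
        [of "f (x + of_int m * p) - c powi m *\<^sub>C F n x" "c powi m *\<^sub>C F n x - c powi m *\<^sub>C f x"]
      by (simp add: shift dist_norm norm_minus_commute)
  qed
  then show "\<exists>p>0. \<forall>m\<in>shift_indices I. \<forall>x\<in>I. norm (f (x + of_int m * p) - c powi m *\<^sub>C f x) \<le> \<epsilon>"
    using p by blast
qed (rule f)

lemma bounded_image_dist_le:
  assumes f: "bounded (f ` I)" and g: "\<And>x. x \<in> I \<Longrightarrow> dist (g x) (f x) \<le> e"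
  shows "bounded (g ` I)"
proof -
  obtain a B where B: "\<And>x. x \<in> I \<Longrightarrow> dist a (f x) \<le> B"
    using f unfolding bounded_def by auto
  have "dist a (g x) \<le> B + e" if "x \<in> I" for x
    using dist_triangle2 [of a "g x" "f x"] B [OF that] g [OF that] by linarith
  then show ?thesis
    unfolding bounded_def by blast
qed

theorem theorem2p14:
  fixes c :: complex
    and I :: "real set"
    and f :: "real \<Rightarrow> 'e::complex_banach"
  assumes "cmod c = 1"
    and "I = UNIV \<or> I = {0..}"
    and "continuous_on I f"
    and "bounded (f ` I)"
  shows "semi_c_periodic c I f \<longleftrightarrow>
    (\<exists>F :: nat \<Rightarrow> real \<Rightarrow> 'e.
       (\<forall>n. continuous_on I (F n) \<and> bounded (F n ` I) \<and> c_periodic c I (F n)) \<and>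
       uniform_limit I F f sequentially)"
proof
  assume semi: "semi_c_periodic c I f"
  have "\<exists>g. continuous_on I g \<and> c_periodic c I g \<and> (\<forall>x\<in>I. dist (g x) (f x) \<le> 2 * (1 / real (Suc n)))"
    for n
    using semi_c_periodic_approx [OF assms(1,2) semi, of "1 / real (Suc n)"]
    by (metis divide_pos_pos of_nat_0_less_iff zero_less_Suc zero_less_one)
  then obtain F where F: "\<And>n. continuous_on I (F n)" "\<And>n. c_periodic c I (F n)"
    and close: "\<And>n x. x \<in> I \<Longrightarrow> dist (F n x) (f x) \<le> 2 * (1 / real (Suc n))"
    by metis
  have "bounded (F n ` I)" for n
    using bounded_image_dist_le [OF assms(4) close] by blast
  moreover have "uniform_limit I F f sequentially"
  proof (rule uniform_limitI)
    fix e :: real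
    assume "e > 0"
    have "(\<lambda>n. 2 * (1 / real (Suc n))) \<longlonglongrightarrow> 0"
      using tendsto_mult_right_zero [OF LIMSEQ_inverse_real_of_nat, of 2]
      by (simp add: inverse_eq_divide)
    then have "\<forall>\<^sub>F n in sequentially. 2 * (1 / real (Suc n)) < e"
      using \<open>e > 0\<close> by (rule order_tendstoD)
    then show "\<forall>\<^sub>F n in sequentially. \<forall>x\<in>I. dist (F n x) (f x) < e"
      by eventually_elim (use close in \<open>blast intro: le_less_trans\<close>)
  qed
  ultimately show "\<exists>F. (\<forall>n. continuous_on I (F n) \<and> bounded (F n ` I) \<and> c_periodic c I (F n)) \<and>
       uniform_limit I F f sequentially"
    using F by blast
next
  assume "\<exists>F. (\<forall>n. continuous_on I (F n) \<and> bounded (F n ` I) \<and> c_periodic c I (F n)) \<and>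
       uniform_limit I F f sequentially"
  then show "semi_c_periodic c I f"
    using uniform_limit_c_periodic_imp_semi_c_periodic [OF assms(1-3)] by blast
qed

end
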